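(* Let $S$ be either (i) a commutative semigroup whose universal semilattice is well-founded, or (ii) a solvable inverse semigroup whose semilattice of idempotents is well-founded. Then every nonprincipal strongly productive ultrafilter on $S$ is regular.
   Context: For a sequence $\vec{x}=(x_n)_{n\in\omega}$ in a semigroup $S$, $\mathrm{FP}(\vec{x})$ is the set of all products $\prod_{i\in a}x_i$ (in increasing order of indices), $a$ ranging over finite nonempty subsets of $\omega$, and $\mathrm{FP}_k(\vec{x})=\mathrm{FP}((x_{n+k})_{n\in\omega})$. An ultrafilter $p$ on $S$ is strongly productive if every $A\in p$ contains some $\mathrm{FP}(\vec{x})$ which belongs to $p$. A nonprincipal strongly productive ultrafilter $p$ is regular if there is $B\in p$ such that for every sequence $\vec{x}$ with $\mathrm{FP}(\vec{x})\subseteq B$, the set $x_0\mathrm{FP}_1(\vec{x})=\{x_0y: y\in\mathrm{FP}_1(\vec{x})\}$ does not belong to $p$. The universal semilattice of $S$ is the quotient by its smallest semilattice congruence; a semilattice is ordered by $x\le y$ iff $xy=x$, and is well-founded if every nonempty subset has a minimal element. Solvable inverse semigroups are in the sense of Piochi: class-$1$ solvable inverse semigroups are the commutative inverse semigroups, and one of class $n+1$ has a congruence $\gamma$ with $S/\gamma$ commutative such that $f^{-1}[E(S/\gamma)]$ (with $f$ the quotient map, $E(\cdot)$ the set of idempotents) is a solvable inverse subsemigroup of class $n$. *)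

theory Defs
  imports Main
begin

fun lprod :: "'a::semigroup_mult list \<Rightarrow> 'a" where
  "lprod [] = undefined"
| "lprod (y # ys) = foldl (*) y ys"

definition FP :: "(nat \<Rightarrow> 'a::semigroup_mult) \<Rightarrow> 'a set" where
  "FP x = {lprod (map x (sorted_list_of_set a)) | a. finite a \<and> a \<noteq> {}}"

definition FPk :: "nat \<Rightarrow> (nat \<Rightarrow> 'a::semigroup_mult) \<Rightarrow> 'a set" where
  "FPk k x = FP (\<lambda>n. x (n + k))"

definition is_ultrafilter :: "'a set set \<Rightarrow> bool" where
  "is_ultrafilter p \<longleftrightarrow> UNIV \<in> p \<and> {} \<notin> p
     \<and> (\<forall>A B. A \<in> p \<longrightarrow> A \<subseteq> B \<longrightarrow> B \<in> p)
     \<and> (\<forall>A B. A \<in> p \<longrightarrow> B \<in> p \<longrightarrow> A \<inter> B \<in> p)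
     \<and> (\<forall>A. A \<in> p \<or> - A \<in> p)"

definition nonprincipal :: "'a set set \<Rightarrow> bool" where
  "nonprincipal p \<longleftrightarrow> (\<forall>s. {s} \<notin> p)"

definition strongly_productive :: "'a::semigroup_mult set set \<Rightarrow> bool" where
  "strongly_productive p \<longleftrightarrow> is_ultrafilter p \<and>
     (\<forall>A \<in> p. \<exists>x. FP x \<subseteq> A \<and> FP x \<in> p)"

definition regular_up :: "'a::semigroup_mult set set \<Rightarrow> bool" where
  "regular_up p \<longleftrightarrow> nonprincipal p \<and> strongly_productive p \<and>
     (\<exists>B \<in> p. \<forall>x. FP x \<subseteq> B \<longrightarrow> (\<lambda>y. x 0 * y) ` FPk 1 x \<notin> p)"

definition congruence_on :: "'a::semigroup_mult set \<Rightarrow> ('a \<times> 'a) set \<Rightarrow> bool" where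
  "congruence_on T r \<longleftrightarrow> equiv T r \<and>
     (\<forall>a b c d. (a, b) \<in> r \<longrightarrow> (c, d) \<in> r \<longrightarrow> (a * c, b * d) \<in> r)"

definition semilattice_congruence :: "('a::semigroup_mult \<times> 'a) set \<Rightarrow> bool" where
  "semilattice_congruence r \<longleftrightarrow> congruence_on UNIV r \<and>
     (\<forall>x. (x * x, x) \<in> r) \<and> (\<forall>x y. (x * y, y * x) \<in> r)"

definition sigma_min :: "('a::semigroup_mult \<times> 'a) set" where
  "sigma_min = \<Inter> {r. semilattice_congruence r}"

text \<open>Order of the universal semilattice S/sigma: C \<le> D iff C D = C.\<close>
definition univ_le :: "'a::semigroup_mult set \<Rightarrow> 'a set \<Rightarrow> bool" where
  "univ_le C D \<longleftrightarrow> (\<exists>x \<in> C. \<exists>y \<in> D. (x * y, x) \<in> sigma_min)"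

definition univ_semilattice_wf :: "'a::semigroup_mult itself \<Rightarrow> bool" where
  "univ_semilattice_wf _ \<longleftrightarrow>
     (\<forall>A. A \<subseteq> (UNIV :: 'a set) // sigma_min \<and> A \<noteq> {} \<longrightarrow>
        (\<exists>m \<in> A. \<forall>a \<in> A. univ_le a m \<longrightarrow> a = m))"

section \<open>Inverse semigroups and solvability (Piochi)\<close>

definition inverse_subsemigroup :: "'a::semigroup_mult set \<Rightarrow> bool" where
  "inverse_subsemigroup T \<longleftrightarrow> (\<forall>x \<in> T. \<forall>y \<in> T. x * y \<in> T) \<and>
     (\<forall>x \<in> T. \<exists>!y. y \<in> T \<and> x * y * x = x \<and> y * x * y = y)"

fun solvable_class :: "nat \<Rightarrow> 'a::semigroup_mult set \<Rightarrow> bool" where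
  "solvable_class 0 T = False"
| "solvable_class (Suc 0) T \<longleftrightarrow> inverse_subsemigroup T \<and> (\<forall>x \<in> T. \<forall>y \<in> T. x * y = y * x)"
| "solvable_class (Suc (Suc n)) T \<longleftrightarrow> inverse_subsemigroup T \<and>
     (\<exists>\<gamma>. congruence_on T \<gamma> \<and> (\<forall>x \<in> T. \<forall>y \<in> T. (x * y, y * x) \<in> \<gamma>) \<and>
        solvable_class (Suc n) {x \<in> T. (x * x, x) \<in> \<gamma>})"

definition solvable_inverse_semigroup :: "'a::semigroup_mult itself \<Rightarrow> bool" where
  "solvable_inverse_semigroup _ \<longleftrightarrow> (\<exists>n. solvable_class n (UNIV :: 'a set))"

definition idempotents_wf :: "'a::semigroup_mult itself \<Rightarrow> bool" where
  "idempotents_wf _ \<longleftrightarrow>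
     (\<forall>A. A \<subseteq> {e :: 'a. e * e = e} \<and> A \<noteq> {} \<longrightarrow>
        (\<exists>m \<in> A. \<forall>a \<in> A. a * m = a \<longrightarrow> a = m))"

end

(* If C in p carries a commutative cancellative congruence r, then either x^2 r x for p-almost all x,
   or p is regular: by Katetov's lemma on finite colourings some B in p has no x, y with y^2 r x,
   whereas three products in x_0 FP_1(x) that are related by z_0 z_1 = z give, after cancellation,
   two finite products of x with y^2 r x.
   Well-foundedness reduces to this situation. Take a minimal s with {y. y <= s} in p (in the
   semilattice at hand). If p does not concentrate on the component of s, then the rest B of
   {y. y <= s} witnesses regularity, since x_0 FP_1(x) lies below x_0 < s. In an archimedean
   component of a commutative semigroup, the exceptional case x^2 r x leaves a nilsemigroup, where
   products of enough elements of x_0 FP_1(x) contain a power x_0^n that is already zero. In a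
   solvable inverse semigroup the exceptional case moves p to a subsemigroup of smaller class. *)

theory Submission
  imports Defs "HOL-Library.Multiset"
begin

section \<open>Finite products\<close>

lemma foldl_mult_left:
  "foldl (*) (a * b) xs = a * foldl (*) (b :: 'a::semigroup_mult) xs"
  by (induction xs arbitrary: b) (simp_all add: mult.assoc)

lemma foldl_mult_lprod:
  "xs \<noteq> [] \<Longrightarrow> foldl (*) t xs = t * lprod (xs :: 'a::semigroup_mult list)"
  by (cases xs) (simp_all add: foldl_mult_left)

lemma lprod_append:
  "xs \<noteq> [] \<Longrightarrow> ys \<noteq> [] \<Longrightarrow> lprod (xs @ ys) = lprod xs * lprod (ys :: 'a::semigroup_mult list)"
  by (cases xs) (simp_all add: foldl_mult_lprod)

text \<open>Names products by their index sets, so that identities between products can be derived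
  from identities between sets.\<close>

definition fprod :: "(nat \<Rightarrow> 'a::semigroup_mult) \<Rightarrow> nat set \<Rightarrow> 'a" where
  "fprod x a = lprod (map x (sorted_list_of_set a))"

lemma fprod_in_FP: "finite a \<Longrightarrow> a \<noteq> {} \<Longrightarrow> fprod x a \<in> FP x"
  by (auto simp: FP_def fprod_def)

lemma fprod_singleton [simp]: "fprod x {n} = x n"
  by (simp add: fprod_def)

lemma in_FP: "x n \<in> FP x"
  using fprod_in_FP[of "{n}" x] by simp

lemma fprod_shift: "fprod (\<lambda>n. x (Suc n)) a = fprod x (Suc ` a)"
proof -
  have "sorted_list_of_set (Suc ` a) = map Suc (sorted_list_of_set a)" if "finite a"
    using that sorted_list_of_set.idem_if_sorted_distinct[of "map Suc (sorted_list_of_set a)"]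
    by (simp add: sorted_map distinct_map)
  then show ?thesis
    by (cases "finite a") (auto simp: fprod_def comp_def finite_image_iff)
qed

lemma fprod_insert_less:
  assumes "finite a" "a \<noteq> {}" "\<forall>i\<in>a. n < i"
  shows "fprod x (insert n a) = x n * fprod x a"
proof -
  have "sorted_list_of_set (insert n a) = n # sorted_list_of_set a"
    using assms by (subst sorted_list_of_set_nonempty) (auto simp: Min_insert2 less_imp_le)
  moreover have "sorted_list_of_set a \<noteq> []"
    using assms by simp
  ultimately show ?thesis
    by (simp add: fprod_def foldl_mult_lprod)
qed

text \<open>The shift of the sequence is traded for the omission of index 0, so that one sequence
  \<open>x\<close> serves both sets.\<close>

lemma FPk_1_eq: "FPk 1 x = {fprod x a | a. finite a \<and> a \<noteq> {} \<and> 0 \<notin> a}"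
proof -
  have "FPk 1 x = {fprod x (Suc ` a) | a. finite a \<and> a \<noteq> {}}"
    by (simp add: FPk_def FP_def fprod_shift fprod_def[symmetric])
  also have "\<dots> = {fprod x a | a. finite a \<and> a \<noteq> {} \<and> 0 \<notin> a}"
  proof (intro equalityI subsetI; clarsimp)
    fix a :: "nat set" assume "finite a" "a \<noteq> {}"
    then show "\<exists>b. fprod x (Suc ` a) = fprod x b \<and> finite b \<and> b \<noteq> {} \<and> 0 \<notin> b"
      by (intro exI[of _ "Suc ` a"]) auto
  next
    fix a :: "nat set" assume a: "finite a" "a \<noteq> {}" "0 \<notin> a"
    have "Suc (n - 1) = n" if "n \<in> a" for n
      using a(3) that by (cases n) auto
    then have "a = Suc ` (\<lambda>n. n - 1) ` a"
      by (simp add: image_image)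
    with a show "\<exists>b. fprod x a = fprod x (Suc ` b) \<and> finite b \<and> b \<noteq> {}"
      by (intro exI[of _ "(\<lambda>n. n - 1) ` a"]) auto
  qed
  finally show ?thesis .
qed

lemma FPk_1_subset: "FPk 1 x \<subseteq> FP x"
  unfolding FPk_1_eq by (auto intro: fprod_in_FP)

text \<open>Prepending \<open>x 0\<close> adds 0 to the index set. That all these index sets share 0
  later keeps the derived index sets nonempty.\<close>

lemma head_FPk_1:
  assumes "y \<in> (\<lambda>y. x 0 * y) ` FPk 1 x"
  obtains a where "finite a" "0 \<in> a" "y = fprod x a"
proof -
  from assms obtain b where b: "finite b" "b \<noteq> {}" "0 \<notin> b" "y = x 0 * fprod x b"
    unfolding FPk_1_eq by auto
  with fprod_insert_less[of b 0 x] have "y = fprod x (insert 0 b)"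
    by (metis gr0I)
  with b that[of "insert 0 b"] show ?thesis by blast
qed

section \<open>Ultrafilters\<close>

lemma strongly_productiveD:
  assumes "strongly_productive p"
  shows "is_ultrafilter p" and "A \<in> p \<Longrightarrow> \<exists>x. FP x \<subseteq> A \<and> FP x \<in> p"
  using assms by (auto simp: strongly_productive_def)

lemma ultrafilterD:
  assumes "is_ultrafilter p"
  shows "UNIV \<in> p" "{} \<notin> p" "A \<in> p \<Longrightarrow> A \<subseteq> B \<Longrightarrow> B \<in> p"
    "A \<in> p \<Longrightarrow> B \<in> p \<Longrightarrow> A \<inter> B \<in> p" "A \<in> p \<or> - A \<in> p"
  using assms unfolding is_ultrafilter_def by blast+

lemma ultrafilter_Diff:
  assumes "is_ultrafilter p" "A \<in> p" "B \<notin> p"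
  shows "A - B \<in> p"
  using ultrafilterD(4)[OF assms(1,2), of "- B"] ultrafilterD(5)[OF assms(1), of B] assms(3)
  by (auto simp: Diff_eq)

text \<open>If no colour class were in \<open>p\<close>, removing the classes one at a time would
  stay inside \<open>p\<close> and end at the empty set.\<close>

lemma ultrafilter_colour_class:
  fixes c :: "'a \<Rightarrow> nat"
  assumes "is_ultrafilter p" "\<And>x. c x < n"
  shows "\<exists>i. {x. c x = i} \<in> p"
proof (rule ccontr)
  assume no: "\<not> ?thesis"
  have "{x. c x \<ge> k} \<in> p" for k
  proof (induction k)
    case (Suc k)
    have "{x. c x \<ge> k} - {x. c x = k} \<in> p"
      using Suc no assms(1) by (intro ultrafilter_Diff) auto
    moreover have "{x. c x \<ge> k} - {x. c x = k} = {x. c x \<ge> Suc k}" by auto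
    ultimately show ?case by simp
  qed (use ultrafilterD(1)[OF assms(1)] in simp)
  from this[of n] show False
    using assms(2) ultrafilterD(2)[OF assms(1)] by (simp add: not_le[symmetric])
qed

lemma regular_upI:
  assumes "nonprincipal p" "strongly_productive p" "B \<in> p"
    and "\<And>x. FP x \<subseteq> B \<Longrightarrow> (\<lambda>y. x 0 * y) ` FPk 1 x \<in> p \<Longrightarrow> False"
  shows "regular_up p"
  using assms unfolding regular_up_def by blast

text \<open>Katetov's lemma. In a component of the functional graph of \<open>f\<close> that contains a cycle, the
  distance to a fixed point \<open>r\<close> of the cycle is coloured modulo 2, with a third colour for \<open>r\<close>;
  in a component without a cycle the height relative to \<open>r\<close> is well defined.\<close>
lemma three_colouring:
  fixes f :: "'a \<Rightarrow> 'a"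
  shows "\<exists>c :: 'a \<Rightarrow> nat. (\<forall>x. c x < 3) \<and> (\<forall>x. f x \<noteq> x \<longrightarrow> c (f x) \<noteq> c x)"
proof -
  define E where "E x y \<longleftrightarrow> (\<exists>m n. (f ^^ m) x = (f ^^ n) y)" for x y
  define per where "per q \<longleftrightarrow> (\<exists>k>0. (f ^^ k) q = q)" for q
  have E_refl: "E x x" for x unfolding E_def by blast
  have E_sym: "E x y \<Longrightarrow> E y x" for x y unfolding E_def by metis
  have E_trans: "E x z" if xy: "E x y" and yz: "E y z" for x y z
  proof -
    obtain m n where 1: "(f ^^ m) x = (f ^^ n) y" using xy unfolding E_def by blast
    obtain k l where 2: "(f ^^ k) y = (f ^^ l) z" using yz unfolding E_def by blast
    have "(f ^^ (k + m)) x = (f ^^ (n + k)) y"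
      using 1 by (simp add: funpow_add) (metis add.commute comp_apply funpow_add)
    also have "\<dots> = (f ^^ (n + l)) z"
      using 2 by (simp add: funpow_add)
    finally show ?thesis unfolding E_def by blast
  qed
  have E_f: "E x (f x)" for x
    unfolding E_def by (rule exI[of _ 1], rule exI[of _ 0]) simp
  \<comment> \<open>\<open>R x\<close> depends only on the component of \<open>x\<close>:
    \<open>E (f x)\<close> and \<open>E x\<close> are equal as predicates, so the choice returns the
    same element for both.\<close>
  define R where "R x = (SOME r. E x r \<and> ((\<exists>q. E x q \<and> per q) \<longrightarrow> per r))" for x
  have "\<exists>r. E x r \<and> ((\<exists>q. E x q \<and> per q) \<longrightarrow> per r)" for x
    using E_refl by blast
  then have R: "E x (R x) \<and> ((\<exists>q. E x q \<and> per q) \<longrightarrow> per (R x))" for x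
    unfolding R_def by (rule someI_ex)
  have "E (f x) = E x" for x
    using E_f E_sym E_trans by blast
  then have R_f: "R (f x) = R x" for x
    by (simp add: R_def)
  define l where "l x = (LEAST i. (f ^^ i) x = R x)" for x
  define ev where "ev x \<longleftrightarrow> (\<exists>m n. (f ^^ m) x = (f ^^ n) (R x) \<and> even (m + n))" for x
  define c :: "'a \<Rightarrow> nat" where "c x = (if per (R x) then if x = R x then 2 else l x mod 2
     else if ev x then 0 else 1)" for x
  have l_f: "l x = Suc (l (f x))" if pr: "per (R x)" "x \<noteq> R x" for x
  proof -
    obtain k where k: "k > 0" "(f ^^ k) (R x) = R x" using pr(1) by (auto simp: per_def)
    obtain m n where mn: "(f ^^ m) x = (f ^^ n) (R x)" using R unfolding E_def by blast
    have kj: "(f ^^ (k * j)) (R x) = R x" for j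
      using k(2) by (induction j) (simp_all add: funpow_add)
    \<comment> \<open>Going on for \<open>n * k - n\<close> steps turns the \<open>n\<close> steps
      from \<open>R x\<close> into \<open>k * n\<close> steps, a multiple of the period;
      \<open>k > 0\<close> makes the subtraction exact.\<close>
    have "(f ^^ (n * k - n + m)) x = (f ^^ (n * k - n + n)) (R x)"
      using mn by (simp add: funpow_add)
    also have "n * k - n + n = k * n"
      using k(1) by (simp add: mult.commute)
    finally have "(f ^^ (n * k - n + m)) x = R x"
      using kj by simp
    then show ?thesis
      unfolding l_def R_f using pr(2)
      by (subst Least_Suc[of _ "n * k - n + m"]) (simp_all add: funpow_swap1 flip: funpow_Suc_right)
  qed
  have ev_f: "ev (f x) \<longleftrightarrow> \<not> ev x" if np: "\<not> per (R x)" for x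
  proof -
    have par: "even (m + n) = even (m' + n')"
      if 1: "(f ^^ m) x = (f ^^ n) (R x)" and 2: "(f ^^ m') x = (f ^^ n') (R x)" for m n m' n'
    proof -
      \<comment> \<open>Equal iterates of \<open>R x\<close> would put a periodic point into the
        component, and then \<open>R x\<close> would have been chosen periodic.\<close>
      have inj: "a = b" if ab: "(f ^^ a) (R x) = (f ^^ b) (R x)" "a \<le> b" for a b
      proof (rule ccontr)
        assume "a \<noteq> b"
        have "(f ^^ (b - a)) ((f ^^ a) (R x)) = (f ^^ (b - a + a)) (R x)"
          by (simp only: funpow_add comp_apply)
        also have "\<dots> = (f ^^ a) (R x)"
          using ab by simp
        finally have "per ((f ^^ a) (R x))"
          unfolding per_def using \<open>a \<noteq> b\<close> ab(2) by (intro exI[of _ "b - a"]) simp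
        moreover have "E (R x) ((f ^^ a) (R x))"
          unfolding E_def by (rule exI[of _ a], rule exI[of _ 0]) simp
        ultimately show False
          using np R E_trans by blast
      qed
      have "(f ^^ (m' + n)) (R x) = (f ^^ (m' + m)) x"
        using 1 by (simp add: funpow_add)
      also have "\<dots> = (f ^^ (m + m')) x" by (simp add: add.commute)
      also have "\<dots> = (f ^^ (m + n')) (R x)"
        using 2 by (simp add: funpow_add)
      finally have "m' + n = m + n'"
        using inj by (metis nle_le)
      then have "even (m' + n) = even (m + n')" by simp
      then show ?thesis by auto
    qed
    obtain m n where mn: "(f ^^ m) x = (f ^^ n) (R x)" using R unfolding E_def by blast
    have mn': "(f ^^ m) (f x) = (f ^^ Suc n) (R x)"
      using arg_cong[OF mn, of f] by (simp add: funpow_swap1)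
    have "ev x \<longleftrightarrow> even (m + n)"
      unfolding ev_def using par mn by blast
    moreover have "ev (f x) \<longleftrightarrow> odd (m + n)"
    proof
      assume "ev (f x)"
      then obtain m' n' where "(f ^^ m') (f x) = (f ^^ n') (R x)" "even (m' + n')"
        unfolding ev_def R_f by blast
      then have "even (Suc m' + n') = even (m + n)"
        by (intro par mn) (simp add: funpow_swap1)
      with \<open>even (m' + n')\<close> show "odd (m + n)" by simp
    next
      assume "odd (m + n)"
      with mn' show "ev (f x)"
        unfolding ev_def R_f by (intro exI[of _ m] exI[of _ "Suc n"]) simp
    qed
    ultimately show ?thesis by simp
  qed
  have "c (f x) \<noteq> c x" if "f x \<noteq> x" for x
  proof (cases "per (R x)")
    case True
    show ?thesis
    proof (cases "x = R x")
      \<comment> \<open>\<open>R x\<close> alone in its component has colour 2, and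
        \<open>f x\<close> differs from it.\<close>
      case True
      then show ?thesis
        using that \<open>per (R x)\<close> by (auto simp: c_def R_f)
    next
      case False
      then show ?thesis
        using l_f[OF True False] True by (auto simp: c_def R_f mod_Suc)
    qed
  next
    case False
    then show ?thesis using ev_f[OF False] by (auto simp: c_def R_f)
  qed
  moreover have "c x < 3" for x
    by (auto simp: c_def less_Suc_eq numeral_3_eq_3)
  ultimately show ?thesis by blast
qed

section \<open>Cancellative commutative congruences\<close>

lemma congruence_onD:
  assumes "congruence_on T r"
  shows "x \<in> T \<Longrightarrow> (x, x) \<in> r" "(x, y) \<in> r \<Longrightarrow> (y, x) \<in> r"
    "(x, y) \<in> r \<Longrightarrow> (y, z) \<in> r \<Longrightarrow> (x, z) \<in> r" "(x, y) \<in> r \<Longrightarrow> x \<in> T"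
    "(x, y) \<in> r \<Longrightarrow> y \<in> T" "(x, y) \<in> r \<Longrightarrow> (u, v) \<in> r \<Longrightarrow> (x * u, y * v) \<in> r"
  using assms unfolding congruence_on_def equiv_def refl_on_def sym_def trans_def by blast+

lemma foldl_mult_closed:
  fixes C :: "'a::semigroup_mult set"
  assumes "\<And>x y. x \<in> C \<Longrightarrow> y \<in> C \<Longrightarrow> x * y \<in> C"
  shows "t \<in> C \<Longrightarrow> set xs \<subseteq> C \<Longrightarrow> foldl (*) t xs \<in> C"
  by (induction xs arbitrary: t) (auto intro: assms)

lemma foldl_mult_cong:
  assumes "congruence_on C r"
  shows "(s, t) \<in> r \<Longrightarrow> set xs \<subseteq> C \<Longrightarrow> (foldl (*) s xs, foldl (*) t xs) \<in> r"
  by (induction xs arbitrary: s t) (simp_all add: congruence_onD(1,6)[OF assms])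

text \<open>Split \<open>ys\<close> at the head \<open>x\<close> of the other list and commute
  \<open>x\<close> past the product of the prefix; the tails follow by induction. The leading factor
  \<open>t\<close> gives meaning to empty lists, as there is no identity element.\<close>

lemma foldl_mult_perm:
  fixes C :: "'a::semigroup_mult set"
  assumes closed: "\<And>x y. x \<in> C \<Longrightarrow> y \<in> C \<Longrightarrow> x * y \<in> C"
    and r: "congruence_on C r"
    and comm: "\<And>x y. x \<in> C \<Longrightarrow> y \<in> C \<Longrightarrow> (x * y, y * x) \<in> r"
  shows "t \<in> C \<Longrightarrow> set xs \<subseteq> C \<Longrightarrow> mset xs = mset ys \<Longrightarrow> (foldl (*) t xs, foldl (*) t ys) \<in> r"
proof (induction xs arbitrary: t ys)
  case Nil
  then show ?case by (simp add: congruence_onD(1)[OF r])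
next
  case (Cons x xs)
  then have "x \<in> set ys" by (metis list.set_intros(1) set_mset_mset)
  then obtain us vs where ys: "ys = us @ x # vs" by (meson split_list)
  have sets: "set us \<subseteq> C" "set vs \<subseteq> C" "x \<in> C" "set xs \<subseteq> C"
    using Cons.prems(2) mset_eq_setD[OF Cons.prems(3)] ys by auto
  have "(foldl (*) (t * x) xs, foldl (*) (t * x) (us @ vs)) \<in> r"
    using Cons.prems ys sets closed by (intro Cons.IH) auto
  moreover have "(foldl (*) (t * x) us, foldl (*) t us * x) \<in> r"
  proof (cases "us = []")
    case True
    then show ?thesis using Cons.prems sets closed by (simp add: congruence_onD(1)[OF r])
  next
    case False
    then obtain u us' where us: "us = u # us'" by (cases us) auto
    then have "lprod us \<in> C" using sets foldl_mult_closed[OF closed, of u us'] by simp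
    then have "(x * lprod us, lprod us * x) \<in> r" using comm sets by blast
    then have "(t * (x * lprod us), t * (lprod us * x)) \<in> r"
      using congruence_onD(6)[OF r congruence_onD(1)[OF r Cons.prems(1)]] by blast
    then show ?thesis using False by (simp add: foldl_mult_lprod mult.assoc)
  qed
  then have "(foldl (*) (t * x) (us @ vs), foldl (*) t ys) \<in> r"
    unfolding ys using foldl_mult_cong[OF r _ sets(2)] by simp
  ultimately show ?case using congruence_onD(3)[OF r] by simp
qed


text \<open>With \<open>u = fprod x\<close> written additively, \<open>u a + u b = u c\<close> gives, after adding
  \<open>u (e - c)\<close> for the symmetric difference \<open>e\<close> of \<open>a\<close> and \<open>b\<close>, that
  \<open>2 u ((e - c) \<union> (a \<inter> b))\<close> and \<open>u ((c - e) \<union> (e - c))\<close> agree up to the summand \<open>u (e \<inter> c)\<close>.\<close>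
lemma fprod_relation_square:
  fixes x :: "nat \<Rightarrow> 'a::semigroup_mult"
  assumes closed: "\<And>x y. x \<in> C \<Longrightarrow> y \<in> C \<Longrightarrow> x * y \<in> C"
    and r: "congruence_on C r"
    and comm: "\<And>x y. x \<in> C \<Longrightarrow> y \<in> C \<Longrightarrow> (x * y, y * x) \<in> r"
    and cancel: "\<And>t x y. t \<in> C \<Longrightarrow> x \<in> C \<Longrightarrow> y \<in> C \<Longrightarrow> (t * x, t * y) \<in> r \<Longrightarrow> (x, y) \<in> r"
    and x: "\<And>n. x n \<in> C"
    and fin: "finite a" "finite b" "finite c"
    and zero: "0 \<in> a" "0 \<in> b" "0 \<in> c"
    and rel: "fprod x a * fprod x b = fprod x c"
  obtains u v where "finite u" "u \<noteq> {}" "finite v" "v \<noteq> {}"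
    "(fprod x u * fprod x u, fprod x v) \<in> r"
proof -
  define e where "e = (a - b) \<union> (b - a)"
  define u where "u = (e - c) \<union> (a \<inter> b)"
  define v where "v = (c - e) \<union> (e - c)"
  define L where "L = (\<lambda>a. map x (sorted_list_of_set a))"
  \<comment> \<open>\<open>e - c\<close> and \<open>e \<inter> c\<close> may be empty, so all
    products get the extra leading factor \<open>x 0\<close>, which is cancelled at the end.\<close>
  define F where "F = (\<lambda>xs. foldl (*) (x 0) xs)"
  note defs = e_def u_def v_def
  have fin': "finite e" "finite u" "finite v" and ne: "u \<noteq> {}" "v \<noteq> {}"
    using fin zero by (auto simp: defs)
  have setL: "set (L w) \<subseteq> C" for w
    using x by (auto simp: L_def)
  have FC: "set xs \<subseteq> C \<Longrightarrow> F xs \<in> C" for xs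
    unfolding F_def using x by (intro foldl_mult_closed closed)
  have msetL: "mset (L w) = image_mset x (mset_set w)" if "finite w" for w
    using that mset_sorted_list_of_multiset[of "mset_set w"] by (simp add: L_def)
  have perm: "(F xs, F ys) \<in> r" if "set xs \<subseteq> C" "mset xs = mset ys" for xs ys
    unfolding F_def using that x by (intro foldl_mult_perm[where C = C] closed r comm) auto
  have L_app: "foldl (*) t (L w) = t * fprod x w" if "finite w" "w \<noteq> {}" for t w
    using that by (simp add: L_def fprod_def foldl_mult_lprod)
  have "F (L a @ L b) = F (L c)"
  proof -
    have "a \<noteq> {}" "b \<noteq> {}" "c \<noteq> {}" using zero by auto
    then show ?thesis using fin rel by (simp add: F_def L_app mult.assoc)
  qed
  then have eq: "F (L a @ L b @ L (e - c)) = F (L c @ L (e - c))"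
    by (simp add: F_def)
  have "(F (L (e \<inter> c) @ L u @ L u), F (L a @ L b @ L (e - c))) \<in> r"
  proof (intro perm)
    \<comment> \<open>As multisets, \<open>a + b\<close> is \<open>e\<close> plus twice
      \<open>a \<inter> b\<close>, and \<open>e\<close> splits into \<open>e \<inter> c\<close> and
      \<open>e - c\<close>; a further \<open>e - c\<close> completes two copies of
      \<open>u\<close>.\<close>
    have "mset_set (e \<inter> c) + mset_set u + mset_set u = mset_set a + mset_set b + mset_set (e - c)"
      using fin fin' by (intro multiset_eqI) (auto simp: count_mset_set' defs)
    then have "image_mset x (mset_set (e \<inter> c) + mset_set u + mset_set u)
        = image_mset x (mset_set a + mset_set b + mset_set (e - c))" by simp
    then show "mset (L (e \<inter> c) @ L u @ L u) = mset (L a @ L b @ L (e - c))"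
      using fin fin' by (simp add: msetL add.assoc)
  qed (use setL in auto)
  moreover have "(F (L c @ L (e - c)), F (L (e \<inter> c) @ L v)) \<in> r"
  proof (intro perm)
    have "mset_set c + mset_set (e - c) = mset_set (e \<inter> c) + mset_set v"
      using fin fin' by (intro multiset_eqI) (auto simp: count_mset_set' defs)
    then have "image_mset x (mset_set c + mset_set (e - c))
        = image_mset x (mset_set (e \<inter> c) + mset_set v)" by simp
    then show "mset (L c @ L (e - c)) = mset (L (e \<inter> c) @ L v)"
      using fin fin' by (simp add: msetL)
  qed (use setL in auto)
  ultimately have "(F (L (e \<inter> c) @ L u @ L u), F (L (e \<inter> c) @ L v)) \<in> r"
    using congruence_onD(3)[OF r] by (simp add: eq)
  then have "(F (L (e \<inter> c)) * (fprod x u * fprod x u), F (L (e \<inter> c)) * fprod x v) \<in> r"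
    using fin' ne by (simp add: F_def L_app mult.assoc)
  moreover have "fprod x w \<in> C" if w: "finite w" "w \<noteq> {}" for w
  proof (cases "L w")
    case Nil
    then show ?thesis using w by (simp add: L_def)
  next
    case (Cons y ys)
    then have "fprod x w = foldl (*) y ys" "y \<in> C" "set ys \<subseteq> C"
      using setL[of w] by (auto simp: fprod_def L_def)
    then show ?thesis using foldl_mult_closed[OF closed] by metis
  qed
  then have "fprod x u * fprod x u \<in> C" "fprod x v \<in> C"
    using fin' ne closed by blast+
  ultimately have "(fprod x u * fprod x u, fprod x v) \<in> r"
    using cancel[OF FC[OF setL]] by blast
  then show thesis using that fin' ne by blast
qed

text \<open>An idempotent of a cancellative commutative semigroup is its identity, so in the second
  case \<open>p\<close> contains the preimage of the identity of \<open>C / r\<close>.\<close>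

lemma regular_or_squares_congruent:
  fixes p :: "'a::semigroup_mult set set"
  assumes p: "nonprincipal p" "strongly_productive p"
    and C: "C \<in> p"
    and closed: "\<And>x y. x \<in> C \<Longrightarrow> y \<in> C \<Longrightarrow> x * y \<in> C"
    and r: "congruence_on C r"
    and comm: "\<And>x y. x \<in> C \<Longrightarrow> y \<in> C \<Longrightarrow> (x * y, y * x) \<in> r"
    and cancel: "\<And>t x y. t \<in> C \<Longrightarrow> x \<in> C \<Longrightarrow> y \<in> C \<Longrightarrow> (t * x, t * y) \<in> r \<Longrightarrow> (x, y) \<in> r"
  shows "regular_up p \<or> {x \<in> C. (x * x, x) \<in> r} \<in> p"
proof (rule disjCI)
  let ?D = "{x \<in> C. (x * x, x) \<in> r}"
  assume D: "?D \<notin> p"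
  note uf = strongly_productiveD(1)[OF p(2)]
  \<comment> \<open>Katetov's lemma is applied to squaring on \<open>r\<close>-classes, carried over
    to chosen representatives.\<close>
  define rep where "rep x = (SOME y. (x, y) \<in> r)" for x
  have rep: "(x, rep x) \<in> r" if "x \<in> C" for x
    unfolding rep_def using congruence_onD(1)[OF r that] by (rule someI)
  have rep_eq: "rep x = rep y" if "(x, y) \<in> r" for x y
    unfolding rep_def using congruence_onD(2,3)[OF r] that
    by (intro arg_cong[where f = Eps] ext) blast
  define f where "f x = rep (x * x)" for x
  obtain col :: "'a \<Rightarrow> nat" where col: "\<And>x. col x < 3" "\<And>x. f x \<noteq> x \<Longrightarrow> col (f x) \<noteq> col x"
    using three_colouring[of f] by blast
  obtain i where i: "{x. col (rep x) = i} \<in> p"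
    using ultrafilter_colour_class[OF uf, of "\<lambda>x. col (rep x)" 3] col(1) by auto
  define B where "B = C \<inter> {x. col (rep x) = i} - ?D"
  have B: "B \<in> p"
    unfolding B_def using C i D uf by (intro ultrafilter_Diff ultrafilterD(4)[OF uf])
  have no_square: "(y * y, x) \<notin> r" if xy: "x \<in> B" "y \<in> B" for x y
  proof
    assume "(y * y, x) \<in> r"
    have y: "y \<in> C" "(y, rep y) \<in> r" using xy rep by (auto simp: B_def)
    then have yy: "(y * y, rep y * rep y) \<in> r"
      by (intro congruence_onD(6)[OF r])
    have "f (rep y) = rep x"
      unfolding f_def using rep_eq[OF yy] rep_eq[OF \<open>(y * y, x) \<in> r\<close>] by simp
    \<comment> \<open>\<open>rep x\<close> and \<open>rep y\<close> have the same colour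
      \<open>i\<close>, so \<open>f\<close> must fix \<open>rep y\<close>; this would put
      \<open>y\<close> into the removed set \<open>?D\<close>.\<close>
    with xy col(2)[of "rep y"] have "f (rep y) = rep y"
      by (auto simp: B_def)
    then have "rep (y * y) = rep y"
      unfolding f_def using rep_eq[OF yy] by simp
    then have "(y * y, y) \<in> r"
      using rep[of "y * y"] closed[of y y] y congruence_onD(2,3)[OF r] by metis
    with xy show False by (auto simp: B_def)
  qed
  show "regular_up p"
  proof (rule regular_upI[OF p B])
    fix x assume x: "FP x \<subseteq> B" and A: "(\<lambda>y. x 0 * y) ` FPk 1 x \<in> p" (is "?A \<in> p")
    obtain z where z: "FP z \<subseteq> ?A"
      using strongly_productiveD(2)[OF p(2) A] by blast
    have "fprod z {0, 1} = z 0 * z 1"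
      using fprod_insert_less[of "{1}" 0 z] by simp
    then have "z 0 * z 1 \<in> ?A"
      using z fprod_in_FP[of "{0, 1}" z] by (auto simp del: insert_iff)
    moreover have "z 0 \<in> ?A" "z 1 \<in> ?A"
      using z in_FP by blast+
    ultimately obtain a b c where abc: "finite a" "0 \<in> a" "z 0 = fprod x a"
      "finite b" "0 \<in> b" "z 1 = fprod x b" "finite c" "0 \<in> c" "z 0 * z 1 = fprod x c"
      using head_FPk_1[of _ x] by metis
    have xC: "x n \<in> C" for n
      using x in_FP[of x n] by (auto simp: B_def)
    obtain u v where "finite u" "u \<noteq> {}" "finite v" "v \<noteq> {}"
      "(fprod x u * fprod x u, fprod x v) \<in> r"
    proof (rule fprod_relation_square[OF closed r comm cancel xC abc(1,4,7,2,5,8)])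
      show "fprod x a * fprod x b = fprod x c" using abc by simp
    qed
    then show False
      using no_square x fprod_in_FP by blast
  qed
qed

section \<open>Commutative semigroups\<close>

text \<open>The exponent is \<open>n + 1\<close>, as a semigroup has no zeroth power; hence the
  \<open>Suc\<close> in \<open>pw_add\<close>.\<close>

fun pw :: "'a::semigroup_mult \<Rightarrow> nat \<Rightarrow> 'a" where
  "pw x 0 = x"
| "pw x (Suc n) = x * pw x n"

lemma pw_add: "pw x m * pw x n = pw x (Suc (m + n))"
  by (induction m) (simp_all add: mult.assoc)

lemma pw_pw: "\<exists>k. pw (pw x m) n = pw x k"
proof (induction n)
  case (Suc n)
  then obtain k where "pw (pw x m) n = pw x k" ..
  then have "pw (pw x m) (Suc n) = pw x (Suc (m + k))" by (simp add: pw_add)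
  then show ?case ..
qed auto

text \<open>In a commutative semigroup the symmetric part of this preorder is the Tamura-Kimura
  description of the least semilattice congruence, whose classes are the archimedean
  components.\<close>

definition pw_dvd :: "'a::semigroup_mult \<Rightarrow> 'a \<Rightarrow> bool" where
  "pw_dvd y x \<longleftrightarrow> (\<exists>n w. pw x n = y * w)"

context
  assumes comm: "\<And>x y :: 'a::semigroup_mult. x * y = y * x"
begin

lemma left_comm: "(x :: 'a) * (y * z) = y * (x * z)"
  by (metis comm mult.assoc)

lemmas ac_rules = mult.assoc comm left_comm

lemma pw_mult: "pw ((x :: 'a) * y) n = pw x n * pw y n"
  by (induction n) (simp_all add: ac_rules)

lemma pw_dvd_trans:
  assumes "pw_dvd y x" "pw_dvd z (y :: 'a)"
  shows "pw_dvd z x"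
proof -
  obtain n w where 1: "pw x n = y * w" using assms(1) unfolding pw_dvd_def by blast
  obtain m v where 2: "pw y m = z * v" using assms(2) unfolding pw_dvd_def by blast
  obtain k where "pw (pw x n) m = pw x k" using pw_pw by blast
  then have "pw x k = z * (v * pw w m)"
    by (simp add: 1 2 pw_mult mult.assoc)
  then show ?thesis unfolding pw_dvd_def by blast
qed

lemma pw_dvd_mono:
  assumes "pw x n = y * (w :: 'a)"
  shows "\<exists>w. pw x (n + k) = y * w"
proof (induction k)
  case (Suc k)
  then obtain w where "pw x (n + k) = y * w" by blast
  then have "pw x (n + Suc k) = y * (x * w)" by (simp add: left_comm)
  then show ?case by blast
qed (use assms in auto)

lemma pw_dvd_mult:
  assumes "pw_dvd y x" "pw_dvd v (u :: 'a)"
  shows "pw_dvd (y * v) (x * u)"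
proof -
  obtain n w where 1: "pw x n = y * w" using assms(1) unfolding pw_dvd_def by blast
  obtain m t where 2: "pw u m = v * t" using assms(2) unfolding pw_dvd_def by blast
  obtain w' where "pw x (n + m) = y * w'" using pw_dvd_mono[OF 1] by blast
  moreover obtain t' where "pw u (m + n) = v * t'" using pw_dvd_mono[OF 2] by blast
  ultimately have "pw (x * u) (n + m) = (y * v) * (w' * t')"
    by (simp add: pw_mult add.commute ac_rules)
  then show ?thesis unfolding pw_dvd_def by blast
qed

lemma semilattice_congruence_pw_dvd:
  "semilattice_congruence {(x, y :: 'a). pw_dvd x y \<and> pw_dvd y x}"
proof -
  have refl: "pw_dvd x x" for x :: 'a
    unfolding pw_dvd_def by (intro exI[of _ 1] exI[of _ x]) simp
  have sq: "pw_dvd (x * x) x" for x :: 'a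
    unfolding pw_dvd_def by (intro exI[of _ 2] exI[of _ x]) (simp add: mult.assoc numeral_2_eq_2)
  have sq': "pw_dvd x (x * x)" for x :: 'a
    unfolding pw_dvd_def by (intro exI[of _ 0] exI[of _ x]) simp
  define r where "r = {(x, y :: 'a). pw_dvd x y \<and> pw_dvd y x}"
  have "(x, x) \<in> r" "(x * x, x) \<in> r" "(x * y, y * x) \<in> r" for x y
    using refl sq sq' comm[of x y] by (simp_all add: r_def)
  moreover have "sym r" unfolding r_def by (intro symI) blast
  moreover have "trans r" unfolding r_def using pw_dvd_trans by (intro transI) blast
  moreover have "(a * c, b * d) \<in> r" if "(a, b) \<in> r" "(c, d) \<in> r" for a b c d
    using that pw_dvd_mult unfolding r_def by blast
  ultimately have "semilattice_congruence r"
    unfolding semilattice_congruence_def congruence_on_def equiv_def refl_on_def by simp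
  then show ?thesis unfolding r_def .
qed

text \<open>This is what makes every \<open>sigma_min\<close>-class archimedean: the least
  semilattice congruence lies inside mutual \<open>pw_dvd\<close>.\<close>

lemma sigma_min_pw_dvd: "((x :: 'a), y) \<in> sigma_min \<Longrightarrow> pw_dvd x y"
  using semilattice_congruence_pw_dvd unfolding sigma_min_def by blast

text \<open>The relation \<open>r\<close> below is the smallest cancellative congruence on \<open>C\<close>, and \<open>D\<close> is the
  preimage of the identity of \<open>C / r\<close>, a nilsemigroup whose zero is the idempotent of \<open>C\<close>.\<close>
lemma regular_archimedean:
  fixes p :: "'a set set"
  assumes p: "nonprincipal p" "strongly_productive p"
    and C: "C \<in> p"
    and closed: "\<And>x y. x \<in> C \<Longrightarrow> y \<in> C \<Longrightarrow> x * y \<in> C"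
    and arch: "\<And>x y. x \<in> C \<Longrightarrow> y \<in> C \<Longrightarrow> pw_dvd x y"
  shows "regular_up p"
proof (rule ccontr)
  assume nreg: "\<not> regular_up p"
  note uf = strongly_productiveD(1)[OF p(2)]
  define r where "r = {(x, y). x \<in> C \<and> y \<in> C \<and> (\<exists>t\<in>C. x * t = y * t)}"
  have r: "congruence_on C r"
  proof -
    have "trans r"
    proof (rule transI)
      fix x y z assume "(x, y) \<in> r" "(y, z) \<in> r"
      then obtain s t where st: "s \<in> C" "t \<in> C" "x * s = y * s" "y * t = z * t" and xz: "x \<in> C" "z \<in> C"
        unfolding r_def by blast
      have "x * (s * t) = y * s * t" using st by (simp flip: mult.assoc)
      also have "\<dots> = y * t * s" by (simp add: ac_rules)
      also have "\<dots> = z * (s * t)" using st(4) by (simp add: ac_rules)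
      finally show "(x, z) \<in> r" using xz st closed unfolding r_def by blast
    qed
    moreover have "(a * c, b * d) \<in> r" if "(a, b) \<in> r" "(c, d) \<in> r" for a b c d
    proof -
      from that obtain s t where st: "s \<in> C" "t \<in> C" "a * s = b * s" "c * t = d * t"
        and abcd: "a \<in> C" "b \<in> C" "c \<in> C" "d \<in> C"
        unfolding r_def by blast
      have "a * c * (s * t) = (a * s) * (c * t)" by (simp add: ac_rules)
      also have "\<dots> = b * d * (s * t)" unfolding st by (simp add: ac_rules)
      finally show ?thesis using abcd st closed unfolding r_def by blast
    qed
    moreover have "sym r" unfolding sym_def r_def by force
    moreover have "(x, x) \<in> r" if "x \<in> C" for x using that unfolding r_def by blast
    moreover have "r \<subseteq> C \<times> C" unfolding r_def by blast
    ultimately show ?thesis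
      unfolding congruence_on_def equiv_def refl_on_def by blast
  qed
  have "{x \<in> C. (x * x, x) \<in> r} \<in> p"
  proof -
    have "(x, y) \<in> r" if txy: "t \<in> C" "x \<in> C" "y \<in> C" "(t * x, t * y) \<in> r" for t x y
    proof -
      obtain s where s: "s \<in> C" "t * x * s = t * y * s" using txy unfolding r_def by blast
      then have "x * (t * s) = y * (t * s)" by (simp add: ac_rules)
      then show ?thesis using txy s closed unfolding r_def by blast
    qed
    moreover have "(x * y, y * x) \<in> r" if "x \<in> C" "y \<in> C" for x y
      using that closed congruence_onD(1)[OF r] comm by metis
    ultimately show ?thesis
      using regular_or_squares_congruent[OF p C closed r] nreg by blast
  qed
  moreover define D where "D = {x \<in> C. \<exists>t\<in>C. x * t = t}"
  \<comment> \<open>From \<open>x * x * t = x * t\<close> the element fixed by \<open>x\<close> is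
    \<open>x * t\<close>.\<close>
  moreover have "{x \<in> C. (x * x, x) \<in> r} \<subseteq> D"
    using closed unfolding r_def D_def by (auto simp: mult.assoc)
  ultimately have D: "D \<in> p" using ultrafilterD(3)[OF uf] by blast
  then obtain x0 where x0: "x0 \<in> D" using ultrafilterD(2)[OF uf] by fastforce
  have closed_pw: "pw x n \<in> C" if "x \<in> C" for x n
    using that closed by (induction n) auto
  \<comment> \<open>\<open>x0\<close> fixes \<open>t\<close>, hence also a power of itself that is a
    multiple of \<open>t\<close>; that power is then idempotent.\<close>
  obtain e where e: "e \<in> C" "e * e = e"
  proof -
    obtain t where t: "x0 \<in> C" "t \<in> C" "x0 * t = t" using x0 unfolding D_def by blast
    obtain n w where "pw x0 n = t * w" using arch[OF t(2,1)] unfolding pw_dvd_def by blast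
    then have "x0 * pw x0 n = pw x0 n" using t(3) by (simp flip: mult.assoc)
    then have "pw x0 k * pw x0 n = pw x0 n" for k
      by (induction k) (simp_all add: mult.assoc)
    then show thesis using that closed_pw[OF t(1)] by blast
  qed
  \<comment> \<open>Every power of \<open>e\<close> is \<open>e\<close>, so \<open>e\<close> is a
    multiple of each \<open>t\<close> in \<open>C\<close>, in particular of one fixed by
    \<open>w\<close>.\<close>
  have eD: "e * w = e" if w: "w \<in> D" for w
  proof -
    obtain t where t: "t \<in> C" "w * t = t" using w unfolding D_def by blast
    obtain n v where "pw e n = t * v" using arch[OF t(1) e(1)] unfolding pw_dvd_def by blast
    moreover have "pw e n = e" by (induction n) (simp_all add: e)
    ultimately have ev: "e = t * v" by simp
    have "w * e = (w * t) * v" unfolding ev by (simp add: mult.assoc)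
    then have "w * e = e" using t(2) ev by simp
    then show ?thesis using comm by metis
  qed
  \<comment> \<open>Some power of \<open>x\<close> is a multiple of \<open>e\<close> and so is fixed
    by \<open>e\<close>, whereas \<open>e\<close> absorbs all powers of \<open>x\<close>.\<close>
  have nil: "\<exists>n. pw x n = e" if "x \<in> D" for x
  proof -
    have "x \<in> C" using that unfolding D_def by blast
    then obtain n w where nw: "pw x n = e * w" using arch[OF e(1)] unfolding pw_dvd_def by blast
    have "e * pw x k = e" for k
      using eD[OF that] by (induction k) (simp_all flip: mult.assoc)
    moreover have "e * pw x n = pw x n"
      unfolding nw using e(2) by (simp flip: mult.assoc)
    ultimately show ?thesis by metis
  qed
  have "{e} \<notin> p" using p(1) unfolding nonprincipal_def by blast
  then have B: "D - {e} \<in> p" using D uf ultrafilter_Diff by blast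
  have "regular_up p"
  proof (rule regular_upI[OF p B])
    fix x assume x: "FP x \<subseteq> D - {e}" and A: "(\<lambda>y. x 0 * y) ` FPk 1 x \<in> p" (is "?A \<in> p")
    obtain z where z: "FP z \<subseteq> ?A \<inter> (D - {e})"
      using strongly_productiveD(2)[OF p(2) ultrafilterD(4)[OF uf A B]] by blast
    obtain n where n: "pw (x 0) n = e" using nil in_FP x by blast
    have zn: "\<exists>w\<in>D. z k = x 0 * w" for k
      using z in_FP[of z k] FPk_1_subset[of x] x by blast
    have D_closed: "u * v \<in> D" if uv: "u \<in> D" "v \<in> D" for u v
    proof -
      have "u * v * e = e" using eD uv by (metis comm mult.assoc)
      then show ?thesis using uv e closed unfolding D_def by blast
    qed
    \<comment> \<open>Each of the \<open>k + 1\<close> factors contributes one \<open>x 0\<close>,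
      matching the exponent of \<open>pw (x 0) k\<close>. At \<open>k = n\<close> the product is
      \<open>e * w = e\<close>, which \<open>FP z\<close> avoids.\<close>
    have "\<exists>w\<in>D. lprod (map z [0..<Suc k]) = pw (x 0) k * w" for k
    proof (induction k)
      case 0
      then show ?case using zn[of 0] by auto
    next
      case (Suc k)
      then obtain w where w: "w \<in> D" "lprod (map z [0..<Suc k]) = pw (x 0) k * w" by blast
      obtain w' where w': "w' \<in> D" "z (Suc k) = x 0 * w'" using zn by blast
      have "lprod (map z [0..<Suc (Suc k)]) = lprod (map z [0..<Suc k]) * z (Suc k)"
        using lprod_append[of "map z [0..<Suc k]" "[z (Suc k)]"] by simp
      then have "lprod (map z [0..<Suc (Suc k)]) = pw (x 0) (Suc k) * (w * w')"
        unfolding w w' by (simp add: ac_rules)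
      then show ?case using D_closed w w' by blast
    qed
    then have "lprod (map z [0..<Suc n]) = e" using n eD by metis
    then have "fprod z {0..<Suc n} = e" by (simp only: fprod_def sorted_list_of_set_range)
    moreover have "fprod z {0..<Suc n} \<in> FP z" by (intro fprod_in_FP) auto
    ultimately show False using z by blast
  qed
  with nreg show False by blast
qed

end

section \<open>Reduction to one component of the universal semilattice\<close>

lemma congruence_sigma_min:
  shows "congruence_on UNIV (sigma_min :: ('a::semigroup_mult \<times> 'a) set)"
    and "((x :: 'a) * x, x) \<in> sigma_min" and "((x :: 'a) * y, y * x) \<in> sigma_min"
proof -
  have cong: "congruence_on UNIV r" if "semilattice_congruence r" for r :: "('a \<times> 'a) set"
    using that unfolding semilattice_congruence_def by blast
  show "(x * x, x) \<in> sigma_min" "(x * y, y * x) \<in> sigma_min"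
    unfolding sigma_min_def semilattice_congruence_def by blast+
  have "(a, a) \<in> sigma_min" for a :: 'a
    unfolding sigma_min_def using congruence_onD(1)[OF cong] by blast
  moreover have "sym (sigma_min :: ('a \<times> 'a) set)"
    unfolding sigma_min_def using congruence_onD(2)[OF cong] by (intro symI) blast
  moreover have "trans (sigma_min :: ('a \<times> 'a) set)"
    unfolding sigma_min_def using congruence_onD(3)[OF cong] by (intro transI) blast
  moreover have "(a * c, b * d) \<in> sigma_min"
    if "(a, b) \<in> sigma_min" "(c, d) \<in> sigma_min" for a b c d :: 'a
    using that congruence_onD(6)[OF cong] unfolding sigma_min_def by blast
  ultimately show "congruence_on UNIV (sigma_min :: ('a \<times> 'a) set)"
    unfolding congruence_on_def equiv_def refl_on_def by simp
qed

lemma regular_commutative: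
  fixes p :: "'a::semigroup_mult set set"
  assumes p: "nonprincipal p" "strongly_productive p"
    and comm: "\<And>x y :: 'a. x * y = y * x"
    and wf: "univ_semilattice_wf TYPE('a)"
  shows "regular_up p"
proof -
  note uf = strongly_productiveD(1)[OF p(2)]
  note cong = congruence_onD[OF congruence_sigma_min(1)]
  \<comment> \<open>\<open>p\<close> concentrates on the elements whose class is below that of
    \<open>s\<close>.\<close>
  define P where "P s \<longleftrightarrow> {y. (y * s, y) \<in> sigma_min} \<in> p" for s :: 'a
  have head: "P (x 0)" if A: "(\<lambda>y. x 0 * y) ` FPk 1 x \<in> p" for x
  proof -
    have "(x 0 * w * x 0, x 0 * w) \<in> sigma_min" for w
    proof -
      have "x 0 * w * x 0 = (x 0 * x 0) * w" by (metis comm mult.assoc)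
      then show ?thesis using congruence_sigma_min(2) cong(1,6) by (metis UNIV_I)
    qed
    then have "(\<lambda>y. x 0 * y) ` FPk 1 x \<subseteq> {y. (y * x 0, y) \<in> sigma_min}" by blast
    then show ?thesis unfolding P_def using ultrafilterD(3)[OF uf A] by blast
  qed
  show ?thesis
  proof (cases "\<exists>s. P s")
    \<comment> \<open>The whole semigroup is a witness: a product set \<open>x 0 * FPk 1 x\<close>
      in \<open>p\<close> would yield \<open>P (x 0)\<close>.\<close>
    case False
    show ?thesis
      using regular_upI[OF p ultrafilterD(1)[OF uf]] head False by blast
  next
    case True
    then have "{sigma_min `` {s} | s. P s} \<noteq> {}" by blast
    moreover have "{sigma_min `` {s} | s. P s} \<subseteq> UNIV // sigma_min"
      by (auto simp: quotient_def)
    ultimately obtain s where s: "P s"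
      and min: "\<And>t. P t \<Longrightarrow> univ_le (sigma_min `` {t}) (sigma_min `` {s}) \<Longrightarrow>
        sigma_min `` {t} = sigma_min `` {s}"
      using wf unfolding univ_semilattice_wf_def by (smt (verit, best) mem_Collect_eq)
    let ?C = "{y. (y, s) \<in> sigma_min}"
    show ?thesis
    proof (cases "?C \<in> p")
      case True
      show ?thesis
      proof (rule regular_archimedean[OF comm p True])
        show "x * y \<in> ?C" if "x \<in> ?C" "y \<in> ?C" for x y
          using that cong(6)[of x s y s] cong(3) congruence_sigma_min(2) by blast
        show "pw_dvd x y" if "x \<in> ?C" "y \<in> ?C" for x y
          using that sigma_min_pw_dvd[OF comm] cong(2,3) by blast
      qed
    next
      case False
      have B: "{y. (y * s, y) \<in> sigma_min} - ?C \<in> p" (is "?B \<in> p")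
        using s False uf ultrafilter_Diff unfolding P_def by blast
      show ?thesis
      proof (rule regular_upI[OF p B])
        fix x assume x: "FP x \<subseteq> ?B" and A: "(\<lambda>y. x 0 * y) ` FPk 1 x \<in> p"
        \<comment> \<open>The class of \<open>x 0\<close> is strictly below that of
          \<open>s\<close>, yet \<open>P (x 0)\<close> holds, against minimality.\<close>
        have x0: "(x 0 * s, x 0) \<in> sigma_min" "(x 0, s) \<notin> sigma_min"
          using x in_FP by blast+
        have "univ_le (sigma_min `` {x 0}) (sigma_min `` {s})"
          unfolding univ_le_def using x0(1) cong(1) by blast
        then have "sigma_min `` {x 0} = sigma_min `` {s}"
          using min head[OF A] by blast
        then show False using x0(2) cong(1) by blast
      qed
    qed
  qed
qed

section \<open>Solvable inverse semigroups\<close>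

text \<open>If \<open>x\<close> is the inverse of \<open>a = e * f\<close>, so is
  \<open>f * x * e\<close>; uniqueness gives \<open>x = f * x * e\<close>, which makes
  \<open>x\<close> idempotent. Then \<open>x\<close> and \<open>a\<close> are both inverses of
  \<open>x\<close>, so \<open>a = x\<close>.\<close>

lemma inverse_idempotent_mult:
  fixes e f :: "'a::semigroup_mult"
  assumes inv: "inverse_subsemigroup (UNIV :: 'a set)"
    and e: "e * e = e" and f: "f * f = f"
  shows "(e * f) * (e * f) = e * f"
proof -
  have ex1: "\<exists>!y. x * y * x = x \<and> y * x * y = y" for x :: 'a
    using inv unfolding inverse_subsemigroup_def by auto
  define a where "a = e * f"
  obtain x where x: "a * x * a = a" "x * a * x = x" using ex1 by blast
  have ae: "e * a = a" "a * f = a"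
    unfolding a_def using e f by (simp_all add: mult.assoc flip: mult.assoc[of e e])
  have "a * (f * x * e) * a = a * f * x * (e * a)" by (simp add: mult.assoc)
  then have 1: "a * (f * x * e) * a = a" using ae x by simp
  have "(f * x * e) * a * (f * x * e) = f * x * (e * a * f) * x * e" by (simp add: mult.assoc)
  also have "\<dots> = f * (x * a * x) * e" using ae by (simp add: mult.assoc)
  finally have 2: "(f * x * e) * a * (f * x * e) = f * x * e" using x by simp
  have xfe: "f * x * e = x" using ex1[of a] 1 2 x by blast
  have "x * x = (f * x * e) * (f * x * e)" using xfe by simp
  also have "\<dots> = f * (x * a * x) * e" unfolding a_def by (simp add: mult.assoc)
  finally have "x * x = x" using x xfe by simp
  then have "a = x" using ex1[of x] x by (metis)
  with \<open>x * x = x\<close> show ?thesis by (simp add: a_def)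
qed

text \<open>Both \<open>e * f\<close>, being idempotent, and \<open>f * e\<close> are inverses of
  \<open>e * f\<close>.\<close>

lemma inverse_idempotents_commute:
  fixes e f :: "'a::semigroup_mult"
  assumes inv: "inverse_subsemigroup (UNIV :: 'a set)"
    and e: "e * e = e" and f: "f * f = f"
  shows "e * f = f * e"
proof -
  have ex1: "\<exists>!y. x * y * x = x \<and> y * x * y = y" for x :: 'a
    using inv unfolding inverse_subsemigroup_def by auto
  have ef: "(e * f) * (e * f) = e * f" and fe: "(f * e) * (f * e) = f * e"
    using inverse_idempotent_mult assms by blast+
  have "(e * f) * (f * e) * (e * f) = e * (f * f) * (e * e) * f" by (simp add: mult.assoc)
  also have "\<dots> = e * f" using ef e f by (simp add: mult.assoc)
  finally have 1: "(e * f) * (f * e) * (e * f) = e * f" .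
  have "(f * e) * (e * f) * (f * e) = f * (e * e) * (f * f) * e" by (simp add: mult.assoc)
  also have "\<dots> = f * e" using fe e f by (simp add: mult.assoc)
  finally have 2: "(f * e) * (e * f) * (f * e) = f * e" .
  have "(e * f) * (e * f) * (e * f) = e * f" using ef by simp
  with ex1[of "e * f"] 1 2 show ?thesis by blast
qed

text \<open>\<open>T / g\<close> is a commutative inverse semigroup, hence a semilattice of groups.
  Well-foundedness singles out one of these groups, and cancellation there narrows \<open>p\<close>
  down to its identity, the class of an idempotent \<open>m\<close>.\<close>

lemma regular_or_principal_mod_congruence:
  fixes p :: "'a::semigroup_mult set set"
  assumes p: "nonprincipal p" "strongly_productive p"
    and wf: "idempotents_wf TYPE('a)"
    and inv: "inverse_subsemigroup (UNIV :: 'a set)"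
    and T: "inverse_subsemigroup T" "T \<in> p"
    and g: "congruence_on T g" and comm: "\<And>x y. x \<in> T \<Longrightarrow> y \<in> T \<Longrightarrow> (x * y, y * x) \<in> g"
  shows "regular_up p \<or> (\<exists>m\<in>T. m * m = m \<and> {x \<in> T. (x, m) \<in> g} \<in> p)"
proof -
  note uf = strongly_productiveD(1)[OF p(2)]
  note cong = congruence_onD[OF g]
  have T_closed: "x * y \<in> T" if "x \<in> T" "y \<in> T" for x y
    using T(1) that unfolding inverse_subsemigroup_def by blast
  have T_inv: "\<exists>y\<in>T. x * y * x = x" if "x \<in> T" for x
    using T(1) that unfolding inverse_subsemigroup_def by blast
  \<comment> \<open>\<open>L m\<close> is the preimage of the part of \<open>T / g\<close> on which
    \<open>m\<close> acts as an identity. The members of \<open>I\<close> are genuine idempotents,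
    not merely idempotents modulo \<open>g\<close>, so that \<open>wf\<close> applies to
    them.\<close>
  define L where "L m = {x \<in> T. (m * x, x) \<in> g}" for m
  define I where "I = {m \<in> T. m * m = m \<and> L m \<in> p}"
  have head: "\<exists>y\<in>T. x 0 * y \<in> I \<and>
      (\<forall>m\<in>I. x 0 \<in> L m \<longrightarrow> x 0 * y * m \<in> I)"
    if x: "FP x \<subseteq> T" and A: "(\<lambda>y. x 0 * y) ` FPk 1 x \<in> p" (is "?A \<in> p") for x
  proof -
    have x0: "x 0 \<in> T" using x in_FP by blast
    obtain y where y: "y \<in> T" "x 0 * y * x 0 = x 0" using T_inv[OF x0] by blast
    define f where "f = x 0 * y"
    have f: "f \<in> T" "f * f = f"
      using x0 y T_closed by (auto simp: f_def simp flip: mult.assoc)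
    have fA: "f * w = w" "w \<in> T" if "w \<in> ?A" for w
      using that y x0 x FPk_1_subset[of x] T_closed by (auto simp: f_def simp flip: mult.assoc)
    have "?A \<subseteq> L f" using fA cong(1) by (auto simp: L_def)
    then have fI: "f \<in> I" using f ultrafilterD(3)[OF uf A] by (auto simp: I_def)
    \<comment> \<open>Modulo \<open>g\<close>, \<open>f\<close> is already below \<open>m\<close>,
      but minimality refers to the order of the semigroup itself; \<open>f * m\<close> is below
      \<open>m\<close> there and still acts as an identity on \<open>?A\<close> modulo
      \<open>g\<close>.\<close>
    have "f * m \<in> I" if m: "m \<in> I" "x 0 \<in> L m" for m
    proof -
      have mm: "m \<in> T" "m * m = m" "(m * x 0, x 0) \<in> g" using m by (auto simp: I_def L_def)
      have "(f * m * w, w) \<in> g" if w: "w \<in> ?A" for w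
      proof -
        obtain v where v: "v \<in> T" "w = x 0 * v" using w x FPk_1_subset[of x] by blast
        have "(m * x 0 * v, x 0 * v) \<in> g" using mm v cong(1,6) by blast
        then have "(m * w, w) \<in> g" using v by (simp add: mult.assoc)
        then have "(f * (m * w), f * w) \<in> g" using f cong(1,6) by blast
        then show ?thesis using fA(1)[OF w] by (simp add: mult.assoc)
      qed
      then have "?A \<subseteq> L (f * m)" using fA(2) by (auto simp: L_def)
      moreover have "f * m * (f * m) = f * m"
        using inverse_idempotent_mult[OF inv f(2) mm(2)] .
      ultimately show ?thesis
        using T_closed f mm ultrafilterD(3)[OF uf A] by (auto simp: I_def)
    qed
    with y fI show ?thesis unfolding f_def by blast
  qed
  show ?thesis
  proof (cases "I = {}")
    case True
    then show ?thesis
      using regular_upI[OF p T(2)] head by blast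
  next
    case False
    then obtain m where m: "m \<in> I" and min: "\<And>a. a \<in> I \<Longrightarrow> a * m = a \<Longrightarrow> a = m"
      using wf unfolding idempotents_wf_def I_def
      by (smt (verit, best) mem_Collect_eq subset_iff I_def)
    then have mT: "m \<in> T" "m * m = m" and Lm: "L m \<in> p" by (auto simp: I_def)
    \<comment> \<open>This is the preimage of the maximal subgroup of \<open>T / g\<close> around
      the class of \<open>m\<close>.\<close>
    define C where "C = {x \<in> L m. \<exists>y\<in>T. (x * y, m) \<in> g}"
    show ?thesis
    proof (cases "C \<in> p")
      case True
      have CT: "C \<subseteq> T" by (auto simp: C_def L_def)
      have id: "(m * x, x) \<in> g" if "x \<in> C" for x using that by (auto simp: C_def L_def)
      have closed: "x * y \<in> C" if xy: "x \<in> C" "y \<in> C" for x y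
      proof -
        obtain x' y' where x': "x' \<in> T" "(x * x', m) \<in> g" and y': "y' \<in> T" "(y * y', m) \<in> g"
          using xy unfolding C_def by blast
        have xyT: "x \<in> T" "y \<in> T" using xy CT by auto
        have "(m * (x * y), x * y) \<in> g"
          using id[OF xy(1)] xyT cong(1,6) by (simp flip: mult.assoc)
        moreover have "(x * y * (y' * x'), m) \<in> g"
        proof -
          have "(x * ((y * y') * x'), x * (m * x')) \<in> g"
            using y' x' xyT cong(1,6) by blast
          moreover have "(x * (m * x'), m * x * x') \<in> g"
            using comm[OF xyT(1) mT(1)] x'(1) cong(1,6) by (metis mult.assoc)
          moreover have "(m * x * x', x * x') \<in> g"
            using id[OF xy(1)] x'(1) cong(1,6) by blast
          ultimately show ?thesis
            using x'(2) cong(3) by (metis mult.assoc)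
        qed
        ultimately show ?thesis
          using xyT x' y' T_closed by (auto simp: C_def L_def)
      qed
      define r where "r = g \<inter> C \<times> C"
      have r: "congruence_on C r"
      proof -
        have "(x, x) \<in> r" if "x \<in> C" for x using that cong(1) CT unfolding r_def by blast
        moreover have "sym r" using cong(2) unfolding r_def by (intro symI) blast
        moreover have "trans r" using cong(3) unfolding r_def by (intro transI) blast
        moreover have "(a * c, b * d) \<in> r" if "(a, b) \<in> r" "(c, d) \<in> r" for a b c d
          using that cong(6) closed unfolding r_def by blast
        moreover have "r \<subseteq> C \<times> C" unfolding r_def by blast
        ultimately show ?thesis unfolding congruence_on_def equiv_def refl_on_def by blast
      qed
      have "regular_up p \<or> {x \<in> C. (x * x, x) \<in> r} \<in> p"
      proof (rule regular_or_squares_congruent[OF p True closed r])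
        show "(x * y, y * x) \<in> r" if "x \<in> C" "y \<in> C" for x y
          using that comm closed CT unfolding r_def by blast
        show "(x, y) \<in> r" if txy: "t \<in> C" "x \<in> C" "y \<in> C" "(t * x, t * y) \<in> r" for t x y
        proof -
          obtain t' where t': "t' \<in> T" "(t * t', m) \<in> g" using txy unfolding C_def by blast
          have t: "t \<in> T" "x \<in> T" "y \<in> T" using txy CT by auto
          \<comment> \<open>\<open>t'\<close> inverts \<open>t\<close> modulo \<open>g\<close>, and
            \<open>m\<close> acts as an identity on \<open>C\<close>.\<close>
          have *: "(t' * (t * z), z) \<in> g" if "z \<in> C" for z
          proof -
            have zT: "z \<in> T" using that CT by blast
            have "(t' * t, m) \<in> g" using t' t comm cong(3) by blast
            then have "(t' * t * z, m * z) \<in> g" using zT cong(1,6) by blast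
            then show ?thesis using id[OF that] cong(3) by (metis mult.assoc)
          qed
          have "(t' * (t * x), t' * (t * y)) \<in> g" using txy t' cong(1,6) by (auto simp: r_def)
          then have "(x, y) \<in> g" using * txy cong(2,3) by meson
          then show ?thesis using txy by (simp add: r_def)
        qed
      qed
      \<comment> \<open>In a group only the identity is idempotent: multiply \<open>x * x\<close>
        and \<open>x\<close> by the inverse \<open>x'\<close>.\<close>
      moreover have "{x \<in> C. (x * x, x) \<in> r} \<subseteq> {x \<in> T. (x, m) \<in> g}"
      proof safe
        fix x assume x: "x \<in> C" "(x * x, x) \<in> r"
        then obtain x' where x': "x' \<in> T" "(x * x', m) \<in> g" unfolding C_def by blast
        show "x \<in> T" using x CT by blast
        have "(x * (x * x'), x * x') \<in> g" using x x' cong(1,6) by (auto simp: r_def simp flip: mult.assoc)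
        moreover have "(x * (x * x'), x * m) \<in> g" using x' \<open>x \<in> T\<close> cong(1,6) by blast
        moreover have "(x * m, m * x) \<in> g" using comm \<open>x \<in> T\<close> mT by blast
        ultimately show "(x, m) \<in> g" using id[OF x(1)] x'(2) cong(2,3) by meson
      qed
      ultimately show ?thesis
        using mT ultrafilterD(3)[OF uf] by blast
    next
      case False
      then have B: "L m - C \<in> p" using Lm uf ultrafilter_Diff by blast
      have "regular_up p"
      proof (rule regular_upI[OF p B])
        fix x assume x: "FP x \<subseteq> L m - C" and A: "(\<lambda>y. x 0 * y) ` FPk 1 x \<in> p"
        have x0: "x 0 \<in> L m" "x 0 \<notin> C" "x 0 \<in> T" using x in_FP by (auto simp: L_def)
        have "FP x \<subseteq> T" using x by (auto simp: L_def)
        then obtain y where y: "y \<in> T" "x 0 * y \<in> I" "x 0 * y * m \<in> I"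
          using head[OF _ A] m x0 by blast
        \<comment> \<open>Minimality of \<open>m\<close> puts \<open>m\<close> below
          \<open>x 0 * y\<close>. As \<open>x 0\<close> lies in \<open>L m\<close>, the converse
          holds modulo \<open>g\<close>, so \<open>y\<close> would show that \<open>x 0\<close> is
          in \<open>C\<close>.\<close>
        have "x 0 * y * m = m"
          using min[OF y(3)] mT(2) by (simp add: mult.assoc)
        moreover have "x 0 * y * m = m * (x 0 * y)"
          using inverse_idempotents_commute[OF inv] y(2) mT(2) by (auto simp: I_def)
        moreover have "(m * (x 0 * y), x 0 * y) \<in> g"
          using x0 y(1) cong(1,6) by (auto simp: L_def simp flip: mult.assoc)
        ultimately have "(x 0 * y, m) \<in> g" using cong(2) by metis
        then show False using x0 y(1) by (auto simp: C_def)
      qed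
      then show ?thesis ..
    qed
  qed
qed

section \<open>Induction on the solvability class\<close>

lemma solvable_class_inverse: "solvable_class n T \<Longrightarrow> inverse_subsemigroup T"
  by (induction n T rule: solvable_class.induct) auto

text \<open>The induction shrinks \<open>T\<close> while \<open>p\<close> stays an ultrafilter on
  the whole semigroup; idempotents of \<open>T\<close> are idempotents there, so \<open>wf\<close>
  and \<open>inv\<close> are assumed once for the whole.\<close>

lemma regular_solvable:
  fixes p :: "'a::semigroup_mult set set"
  assumes p: "nonprincipal p" "strongly_productive p"
    and wf: "idempotents_wf TYPE('a)"
    and inv: "inverse_subsemigroup (UNIV :: 'a set)"
  shows "solvable_class n T \<Longrightarrow> T \<in> p \<Longrightarrow> regular_up p"
proof (induction n T rule: solvable_class.induct)
  case (2 T)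
  then have T: "inverse_subsemigroup T" "\<And>x y. x \<in> T \<Longrightarrow> y \<in> T \<Longrightarrow> x * y = y * x" by auto
  then have closed: "x * y \<in> T" if "x \<in> T" "y \<in> T" for x y
    using that unfolding inverse_subsemigroup_def by blast
  \<comment> \<open>For equality the class of \<open>m\<close> is a singleton, which a nonprincipal
    \<open>p\<close> excludes.\<close>
  have "congruence_on T (Id_on T)"
    unfolding congruence_on_def equiv_def refl_on_def sym_def trans_def using closed by auto
  then have "regular_up p \<or> (\<exists>m\<in>T. m * m = m \<and> {x \<in> T. (x, m) \<in> Id_on T} \<in> p)"
    using T closed by (intro regular_or_principal_mod_congruence[OF p wf inv T(1) 2(2)]) auto
  moreover have "{x \<in> T. (x, m) \<in> Id_on T} = {m}" if "m \<in> T" for m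
    using that by auto
  ultimately show ?case using p(1) by (auto simp: nonprincipal_def)
next
  case (3 n T)
  then obtain g where T: "inverse_subsemigroup T" and g: "congruence_on T g"
    and comm: "\<And>x y. x \<in> T \<Longrightarrow> y \<in> T \<Longrightarrow> (x * y, y * x) \<in> g"
    and sol: "solvable_class (Suc n) {x \<in> T. (x * x, x) \<in> g}"
    by auto
  have "regular_up p \<or> (\<exists>m\<in>T. m * m = m \<and> {x \<in> T. (x, m) \<in> g} \<in> p)"
    by (rule regular_or_principal_mod_congruence[OF p wf inv T 3(3) g comm])
  \<comment> \<open>The class of an idempotent lies in the preimage of the idempotents of
    \<open>T / g\<close>, which has smaller solvability class.\<close>
  moreover have "{x \<in> T. (x, m) \<in> g} \<subseteq> {x \<in> T. (x * x, x) \<in> g}" if m: "m * m = m" for m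
  proof safe
    fix x assume x: "(x, m) \<in> g"
    then have "(x * x, m) \<in> g" using congruence_onD(6)[OF g x x] m by simp
    then show "(x * x, x) \<in> g" using congruence_onD(2,3)[OF g] x by blast
  qed
  ultimately have "regular_up p \<or> {x \<in> T. (x * x, x) \<in> g} \<in> p"
    using ultrafilterD(3)[OF strongly_productiveD(1)[OF p(2)]] by blast
  then show ?case
    using 3(1)[OF sol] by blast
qed simp

theorem mainTheorem2:
  fixes p :: "'a::semigroup_mult set set"
  assumes "((\<forall>x y :: 'a. x * y = y * x) \<and> univ_semilattice_wf TYPE('a))
         \<or> (solvable_inverse_semigroup TYPE('a) \<and> idempotents_wf TYPE('a))"
    and "nonprincipal p" and "strongly_productive p"
  shows "regular_up p"
  using assms(1)
proof
  assume "(\<forall>x y :: 'a. x * y = y * x) \<and> univ_semilattice_wf TYPE('a)"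
  then show ?thesis using regular_commutative[OF assms(2,3)] by blast
next
  assume sol: "solvable_inverse_semigroup TYPE('a) \<and> idempotents_wf TYPE('a)"
  then obtain n where n: "solvable_class n (UNIV :: 'a set)"
    unfolding solvable_inverse_semigroup_def by blast
  have "UNIV \<in> p" using assms(3) by (intro ultrafilterD strongly_productiveD)
  then show ?thesis
    using regular_solvable[OF assms(2,3) _ solvable_class_inverse n] sol n by blast
qed

end
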